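(* Let $h>0$, let $\mu,\nu\in[0,1)$, let $\mathsf c_\mu\in\Phi_{h,\mu}(\mathsf c)$ and $\mathsf a_\nu\in\Phi_{h,\nu}(\mathsf a)$ be perturbations of $\mathsf c$ and $\mathsf a$ in the setting described in the context, with Galerkin matrices $\mathbf C_\mu$ and $\mathbf A_\nu$, and put $\mathbf P_\mu:=\mathbf M^{-1}\mathbf C_\mu\mathbf N^{-1}$. Then the spectral condition number satisfies $$\kappa_S(\mathbf P_\mu\mathbf A_\nu)\le K_\star\left(\frac{1+\mu}{1-\mu}\right)\left(\frac{1+\nu}{1-\nu}\right)=:K_{\star,\mu,\nu},\qquad K_\star:=\frac{\|\mathsf m\|\|\mathsf n\|\|\mathsf c\|\|\mathsf a\|}{\gamma_{\mathsf M}\gamma_{\mathsf N}\gamma_{\mathsf C}\gamma_{\mathsf A}},$$ and the Euclidean condition number satisfies $$\kappa_2(\mathbf P_\mu\mathbf A_\nu)\le K_{\star,\mu,\nu}K_{\Lambda_h}^2 .$$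
   Context: Setting. $X,Y,V,W$ are complex reflexive Banach spaces. $\mathsf a$ on $X\times Y$, $\mathsf c$ on $V\times W$, $\mathsf n$ on $V\times Y$ and $\mathsf m$ on $X\times W$ are bounded sesquilinear forms (linear in the first, antilinear in the second argument), with norms $\|\mathsf a\|=\sup_{x\ne0,y\ne0}|\mathsf a(x,y)|/(\|x\|_X\|y\|_Y)$, and similarly $\|\mathsf c\|,\|\mathsf n\|,\|\mathsf m\|$. A prime denotes the space of bounded antilinear functionals. It is assumed that for every $b\in Y'$ there is a unique $u\in X$ with $\mathsf a(u,v)=b(v)$ for all $v\in Y$. For the fixed index $h>0$, $X_h\subset X$, $Y_h\subset Y$, $V_h\subset V$, $W_h\subset W$ are subspaces of the same finite dimension $N$. Discrete inf-sup conditions: there is $\gamma_{\mathsf A}>0$ with $\sup_{v_h\in Y_h\setminus\{0\}}|\mathsf a(u_h,v_h)|/\|v_h\|_Y\ge\gamma_{\mathsf A}\|u_h\|_X$ for all $u_h\in X_h$; likewise $\mathsf c$ on $V_h\times W_h$, $\mathsf n$ on $V_h\times Y_h$, $\mathsf m$ on $X_h\times W_h$ satisfy the analogous condition (supremum over the second argument) with constants $\gamma_{\mathsf C},\gamma_{\mathsf N},\gamma_{\mathsf M}>0$. Perturbations: $\mathsf a_\nu\in\Phi_{h,\nu}(\mathsf a)$ means that $\mathsf a_\nu$ is a bounded sesquilinear form on $X\times Y$ with $\gamma_{\mathsf A}^{-1}|\mathsf a(u_h,v_h)-\mathsf a_\nu(u_h,v_h)|\le\nu\|u_h\|_X\|v_h\|_Y$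 for all $u_h\in X_h,v_h\in Y_h$. Likewise $\mathsf c_\mu\in\Phi_{h,\mu}(\mathsf c)$ means $\mathsf c_\mu$ is a bounded sesquilinear form on $V\times W$ with $\gamma_{\mathsf C}^{-1}|\mathsf c(v_h,w_h)-\mathsf c_\mu(v_h,w_h)|\le\mu\|v_h\|_V\|w_h\|_W$ for all $v_h\in V_h,w_h\in W_h$. Matrices: given bases $\{\varphi_i\}$ of $X_h$, $\{\phi_i\}$ of $Y_h$, $\{\psi_i\}$ of $V_h$, $\{\xi_i\}$ of $W_h$, $\mathbf A_\nu=(\mathsf a_\nu(\varphi_j,\phi_i))_{i,j}$, $\mathbf C_\mu=(\mathsf c_\mu(\psi_j,\xi_i))_{i,j}$, $\mathbf N=(\mathsf n(\psi_j,\phi_i))_{i,j}$, $\mathbf M=(\mathsf m(\varphi_j,\xi_i))_{i,j}$, $1\le i,j\le N$. Condition numbers: for an invertible matrix $\mathbf Q$, $\kappa_S(\mathbf Q)=\varrho(\mathbf Q)\varrho(\mathbf Q^{-1})$ with $\varrho$ the spectral radius, and $\kappa_2(\mathbf Q)=\|\mathbf Q\|_2\|\mathbf Q^{-1}\|_2$ with $\|\cdot\|_2$ the matrix norm induced by the Euclidean norm. Synthesis operator: $\Lambda_h:\mathbb C^N\to X_h$, $\mathbf u=(u_i)\mapsto u_h=\sum_iu_i\varphi_i$; $\gamma_{\Lambda_h}=\inf_{u_h\in X_h\setminus\{0\}}\|u_h\|_X/\|\mathbf u\|_2$, $\|\Lambda_h\|=\sup_{u_h\in X_h\setminus\{0\}}\|u_h\|_X/\|\mathbf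 u\|_2$, $K_{\Lambda_h}=\|\Lambda_h\|/\gamma_{\Lambda_h}$. *)

theory Defs
  imports "HOL-Analysis.Analysis"
begin

section \<open>Complex Banach spaces\<close>

class complex_banach = banach +
  fixes scaleC :: "complex \<Rightarrow> 'a \<Rightarrow> 'a"  (infixr "*\<^sub>C" 75)
  assumes scaleC_add_right: "z *\<^sub>C (x + y) = z *\<^sub>C x + z *\<^sub>C y"
    and scaleC_add_left: "(z + w) *\<^sub>C x = z *\<^sub>C x + w *\<^sub>C x"
    and scaleC_scaleC: "z *\<^sub>C w *\<^sub>C x = (z * w) *\<^sub>C x"
    and scaleC_one: "1 *\<^sub>C x = x"
    and scaleR_scaleC: "r *\<^sub>R x = complex_of_real r *\<^sub>C x"
    and norm_scaleC: "norm (z *\<^sub>C x) = cmod z * norm x"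

global_interpretation complex_vector: vector_space "scaleC :: complex \<Rightarrow> 'a::complex_banach \<Rightarrow> 'a"
  by unfold_locales
    (simp_all add: scaleC_add_right scaleC_add_left scaleC_scaleC scaleC_one)

definition bounded_antilinear :: "('a::complex_banach \<Rightarrow> complex) \<Rightarrow> bool" where
  "bounded_antilinear f \<longleftrightarrow>
     (\<forall>x y. f (x + y) = f x + f y) \<and>
     (\<forall>z x. f (z *\<^sub>C x) = cnj z * f x) \<and>
     (\<exists>K. \<forall>x. cmod (f x) \<le> K * norm x)"

text \<open>
  The dual consists of the bounded antilinear functionals, normed by \<^const>\<open>onorm\<close>; the
  bidual consists of the bounded antilinear functionals on the dual, represented by functions of
  which only the values on bounded antilinear arguments matter. The canonical embedding sends
  \<open>x\<close> to \<open>f \<mapsto> cnj (f x)\<close>; the conjugate makes this antilinear in \<open>f\<close> and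
  linear in \<open>x\<close>. Reflexivity is surjectivity of this embedding.
\<close>

definition bounded_antilinear_on_dual :: "(('a::complex_banach \<Rightarrow> complex) \<Rightarrow> complex) \<Rightarrow> bool" where
  "bounded_antilinear_on_dual F \<longleftrightarrow>
     (\<forall>f g. bounded_antilinear f \<longrightarrow> bounded_antilinear g \<longrightarrow> F (\<lambda>x. f x + g x) = F f + F g) \<and>
     (\<forall>z f. bounded_antilinear f \<longrightarrow> F (\<lambda>x. z * f x) = cnj z * F f) \<and>
     (\<exists>K. \<forall>f. bounded_antilinear f \<longrightarrow> cmod (F f) \<le> K * onorm f)"

definition reflexive_space :: "'a::complex_banach itself \<Rightarrow> bool" where
  "reflexive_space _ \<longleftrightarrow>
     (\<forall>F :: ('a \<Rightarrow> complex) \<Rightarrow> complex. bounded_antilinear_on_dual F \<longrightarrow>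
        (\<exists>x. \<forall>f. bounded_antilinear f \<longrightarrow> F f = cnj (f x)))"

section \<open>Sesquilinear forms\<close>

definition bounded_sesquilinear :: "('a::complex_banach \<Rightarrow> 'b::complex_banach \<Rightarrow> complex) \<Rightarrow> bool" where
  "bounded_sesquilinear a \<longleftrightarrow>
     (\<forall>x x' y. a (x + x') y = a x y + a x' y) \<and>
     (\<forall>z x y. a (z *\<^sub>C x) y = z * a x y) \<and>
     (\<forall>x y y'. a x (y + y') = a x y + a x y') \<and>
     (\<forall>z x y. a x (z *\<^sub>C y) = cnj z * a x y) \<and>
     (\<exists>K. \<forall>x y. cmod (a x y) \<le> K * norm x * norm y)"

definition form_norm :: "('a::complex_banach \<Rightarrow> 'b::complex_banach \<Rightarrow> complex) \<Rightarrow> real" where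
  "form_norm a = (SUP (x, y) \<in> (- {0}) \<times> (- {0}). cmod (a x y) / (norm x * norm y))"

definition inf_sup_condition ::
  "('a::complex_banach \<Rightarrow> 'b::complex_banach \<Rightarrow> complex) \<Rightarrow> 'a set \<Rightarrow> 'b set \<Rightarrow> real \<Rightarrow> bool" where
  "inf_sup_condition a Xh Yh \<gamma> \<longleftrightarrow>
     (\<forall>u\<in>Xh. (SUP v\<in>Yh - {0}. cmod (a u v) / norm v) \<ge> \<gamma> * norm u)"

definition perturbations ::
  "real \<Rightarrow> 'a set \<Rightarrow> 'b set \<Rightarrow> real \<Rightarrow> ('a::complex_banach \<Rightarrow> 'b::complex_banach \<Rightarrow> complex) \<Rightarrow>
     ('a \<Rightarrow> 'b \<Rightarrow> complex) set" where
  "perturbations \<gamma> Xh Yh \<nu> a =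
     {b. bounded_sesquilinear b \<and>
         (\<forall>u\<in>Xh. \<forall>v\<in>Yh. inverse \<gamma> * cmod (a u v - b u v) \<le> \<nu> * norm u * norm v)}"

section \<open>Bases, Galerkin matrices and condition numbers\<close>

definition complex_basis :: "('n::finite \<Rightarrow> 'a::complex_banach) \<Rightarrow> 'a set \<Rightarrow> bool" where
  "complex_basis \<phi> S \<longleftrightarrow>
     inj \<phi> \<and> complex_vector.independent (range \<phi>) \<and> complex_vector.span (range \<phi>) = S"

text \<open>The trial function indexes the columns, the test function the rows.\<close>

definition galerkin_matrix ::
  "('a::complex_banach \<Rightarrow> 'b::complex_banach \<Rightarrow> complex) \<Rightarrow> ('n::finite \<Rightarrow> 'a) \<Rightarrow> ('n \<Rightarrow> 'b) \<Rightarrow>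
     complex ^ 'n ^ 'n" where
  "galerkin_matrix a \<phi> \<theta> = (\<chi> i j. a (\<phi> j) (\<theta> i))"

definition spectral_radius :: "complex ^ 'n ^ 'n \<Rightarrow> real" where
  "spectral_radius Q = Sup {cmod z | z. \<exists>v. v \<noteq> 0 \<and> Q *v v = z *s v}"

definition cond_S :: "complex ^ 'n ^ 'n \<Rightarrow> real" where
  "cond_S Q = spectral_radius Q * spectral_radius (matrix_inv Q)"

text \<open>The norm of \<^typ>\<open>complex ^ 'n\<close> is the Euclidean one, so \<^const>\<open>onorm\<close> gives
  the induced matrix norm.\<close>

definition cond_2 :: "complex ^ 'n ^ 'n \<Rightarrow> real" where
  "cond_2 Q = onorm ((*v) Q) * onorm ((*v) (matrix_inv Q))"

definition synthesis :: "('n::finite \<Rightarrow> 'a::complex_banach) \<Rightarrow> complex ^ 'n \<Rightarrow> 'a" where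
  "synthesis \<phi> u = (\<Sum>i\<in>UNIV. (u $ i) *\<^sub>C \<phi> i)"

text \<open>
  For a basis \<open>\<phi>\<close> of \<open>Xh\<close>, the nonzero elements of \<open>Xh\<close> are exactly the nonzero values
  \<open>synthesis \<phi> u\<close>, each with a unique coefficient vector \<open>u\<close>; the extrema below are
  therefore taken over \<open>Xh - {0}\<close>.
\<close>

definition synthesis_lower :: "('n::finite \<Rightarrow> 'a::complex_banach) \<Rightarrow> real" where
  "synthesis_lower \<phi> = (INF u\<in>{u. synthesis \<phi> u \<noteq> 0}. norm (synthesis \<phi> u) / norm u)"

definition synthesis_upper :: "('n::finite \<Rightarrow> 'a::complex_banach) \<Rightarrow> real" where
  "synthesis_upper \<phi> = (SUP u\<in>{u. synthesis \<phi> u \<noteq> 0}. norm (synthesis \<phi> u) / norm u)"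

definition synthesis_cond :: "('n::finite \<Rightarrow> 'a::complex_banach) \<Rightarrow> real" where
  "synthesis_cond \<phi> = synthesis_upper \<phi> / synthesis_lower \<phi>"

end

theory Submission
  imports Defs "HOL-Computational_Algebra.Fundamental_Theorem_Algebra"
begin

text \<open>
  For \<open>z = P\<^sub>\<mu> A\<^sub>\<nu> u\<close> and \<open>w = N\<inverse> A\<^sub>\<nu> u\<close> the functions \<open>u\<^sub>h, w\<^sub>h, z\<^sub>h\<close> satisfy
  \<open>n(w\<^sub>h, y) = a\<^sub>\<nu>(u\<^sub>h, y)\<close> and \<open>m(z\<^sub>h, x) = c\<^sub>\<mu>(w\<^sub>h, x)\<close> for all discrete test functions. Boundedness
  of one side and the inf-sup condition of the other side yield two-sided bounds between the norms
  of \<open>u\<^sub>h\<close> and \<open>z\<^sub>h\<close>. These bound every eigenvalue directly, and the Euclidean norms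
  after passing to coefficients, which costs the factor \<open>K\<^sub>\<Lambda>\<close> once for each matrix.
\<close>

section \<open>Eigenvalues of complex matrices\<close>

text \<open>Horner's scheme for the vector \<open>p(Q) v\<close>. Only the action on a single vector
  is needed, so no matrix powers are formed.\<close>

definition matrix_poly_apply ::
  "complex ^ 'n ^ 'n \<Rightarrow> complex poly \<Rightarrow> complex ^ 'n \<Rightarrow> complex ^ 'n" where
  "matrix_poly_apply Q p v = fold_coeffs (\<lambda>c w. c *s v + Q *v w) p 0"

lemma matrix_poly_apply_0 [simp]: "matrix_poly_apply Q 0 v = 0"
  by (simp add: matrix_poly_apply_def)

lemma matrix_poly_apply_pCons [simp]:
  "matrix_poly_apply Q (pCons c p) v = c *s v + Q *v matrix_poly_apply Q p v"
  \<comment> \<open>\<open>pCons 0 0\<close> collapses to \<open>0\<close>, so the fold performs no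
    step there; both sides are then zero.\<close>
  by (cases "p = 0 \<and> c = 0") (auto simp: matrix_poly_apply_def)

lemma matrix_poly_apply_add:
  "matrix_poly_apply Q (p + q) v = matrix_poly_apply Q p v + matrix_poly_apply Q q v"
  by (induction p q rule: poly_induct2)
    (simp_all add: vec.scale_left_distrib vec.add algebra_simps)

lemma matrix_poly_apply_smult:
  "matrix_poly_apply Q (smult c p) v = c *s matrix_poly_apply Q p v"
  by (induction p) (simp_all add: vec.scale_right_distrib vec.scale)

lemma matrix_poly_apply_sum:
  "matrix_poly_apply Q (\<Sum>i\<in>I. p i) v = (\<Sum>i\<in>I. matrix_poly_apply Q (p i) v)"
  by (induction I rule: infinite_finite_induct) (simp_all add: matrix_poly_apply_add)

lemma matrix_poly_apply_monom:
  "matrix_poly_apply Q (monom c i) v = c *s ((*v) Q ^^ i) v"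
  by (induction i) (simp_all add: monom_0 monom_Suc vec.scale)

text \<open>There is one more vector than the dimension. Dependence of a set ignores repetitions, so
  a non-injective family gets its own relation, with coefficients 1 and -1 at two equal
  members.\<close>

lemma linear_dependence_of_family:
  fixes f :: "nat \<Rightarrow> complex ^ 'n"
  shows "\<exists>g. (\<exists>i\<le>CARD('n). g i \<noteq> 0) \<and> (\<Sum>i\<le>CARD('n). g i *s f i) = 0"
proof (cases "inj_on f {..CARD('n)}")
  case False
  then obtain i j where ij: "i \<le> CARD('n)" "j \<le> CARD('n)" "i \<noteq> j" "f i = f j"
    by (auto simp: inj_on_def)
  define g where "g k = (if k = i then 1 else if k = j then - 1 else 0 :: complex)" for k
  have "(\<Sum>k\<le>CARD('n). g k *s f k) = (\<Sum>k\<in>{i, j}. g k *s f k)"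
    using ij by (intro sum.mono_neutral_right) (auto simp: g_def)
  also have "\<dots> = 0"
    using ij by (simp add: g_def)
  finally show ?thesis
    using ij by (intro exI[of _ g]) (auto simp: g_def)
next
  case True
  let ?S = "f ` {..CARD('n)}"
  have "vec.dependent ?S"
    using vec.independent_card_le_dim[of ?S UNIV] card_image[OF True]
    by (auto simp: vec.dim_UNIV card_cart_basis)
  then obtain g w where "w \<in> ?S" "g w \<noteq> 0" "(\<Sum>w\<in>?S. g w *s w) = 0"
    by (auto simp: vec.dependent_finite)
  then show ?thesis
    using sum.reindex[OF True, of "\<lambda>w. g w *s w"] by (intro exI[of _ "g \<circ> f"]) auto
qed

text \<open>Split off a root: \<open>p = (X - z) q\<close>. Either \<open>q\<close> already
  annihilates \<open>v\<close> and has smaller degree, or \<open>q(Q) v\<close> is an eigenvector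
  for \<open>z\<close>. A nonzero constant cannot annihilate \<open>v\<close>.\<close>

lemma annihilating_polynomial_imp_eigenvector:
  fixes Q :: "complex ^ 'n ^ 'n"
  assumes "p \<noteq> 0" "v \<noteq> 0" "matrix_poly_apply Q p v = 0"
  shows "\<exists>z w. w \<noteq> 0 \<and> Q *v w = z *s w"
  using assms
proof (induction "degree p" arbitrary: p)
  case 0
  then obtain c where "p = [:c:]"
    by (metis degree_0_id)
  with 0 show ?case by simp
next
  case (Suc d)
  then have "\<not> constant (poly p)"
    by (simp add: constant_degree)
  then obtain z where "poly p z = 0"
    using fundamental_theorem_of_algebra by blast
  then obtain q where p: "p = [:- z, 1:] * q"
    by (auto simp: poly_eq_0_iff_dvd)
  with Suc have q: "q \<noteq> 0" by auto
  have "degree p = Suc (degree q)"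
    unfolding p using q by (subst degree_mult_eq) auto
  show ?case
  proof (cases "matrix_poly_apply Q q v = 0")
    case True
    then show ?thesis
      using Suc.hyps \<open>degree p = Suc (degree q)\<close> q Suc.prems(2) by simp
  next
    case False
    have "p = smult (- z) q + pCons 0 q"
      by (simp add: p)
    then have "matrix_poly_apply Q p v = - z *s matrix_poly_apply Q q v + Q *v matrix_poly_apply Q q v"
      by (simp only: matrix_poly_apply_add matrix_poly_apply_smult matrix_poly_apply_pCons
          vec.scale_zero_left add_0)
    then show ?thesis
      using False Suc.prems(3) by (auto simp: add_eq_0_iff)
  qed
qed

text \<open>A linear relation among \<open>v, Q v, ..., Q^n v\<close>, with
  \<open>n = CARD('n)\<close>, is a nonzero polynomial annihilating \<open>v\<close>; no determinant
  is involved.\<close>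

lemma complex_matrix_has_eigenvector:
  fixes Q :: "complex ^ 'n ^ 'n"
  shows "\<exists>z w. w \<noteq> 0 \<and> Q *v w = z *s w"
proof -
  \<comment> \<open>Any nonzero vector would do; this is the all-ones vector.\<close>
  define v :: "complex ^ 'n" where "v = 1"
  obtain g i where g: "i \<le> CARD('n)" "g i \<noteq> 0"
      "(\<Sum>i\<le>CARD('n). g i *s ((*v) Q ^^ i) v) = 0"
    using linear_dependence_of_family[of "\<lambda>i. ((*v) Q ^^ i) v"] by blast
  let ?p = "\<Sum>i\<le>CARD('n). monom (g i) i"
  have "coeff ?p i = g i"
    using g(1) by (simp add: coeff_sum)
  with g(2) have "?p \<noteq> 0"
    by (metis coeff_0)
  moreover have "matrix_poly_apply Q ?p v = 0"
    using g(3) by (simp add: matrix_poly_apply_sum matrix_poly_apply_monom)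
  moreover have "v \<noteq> 0"
    by (simp add: v_def)
  ultimately show ?thesis
    using annihilating_polynomial_imp_eigenvector by blast
qed

text \<open>
  The existence of an eigenvalue matters here: the supremum of an empty set of reals is unspecified.
\<close>

lemma spectral_radius_nonneg_le:
  fixes Q :: "complex ^ 'n ^ 'n"
  assumes "\<And>z v. v \<noteq> 0 \<Longrightarrow> Q *v v = z *s v \<Longrightarrow> cmod z \<le> R"
  shows "0 \<le> spectral_radius Q \<and> spectral_radius Q \<le> R"
proof -
  let ?S = "{cmod z | z. \<exists>v. v \<noteq> 0 \<and> Q *v v = z *s v}"
  obtain z w where zw: "w \<noteq> 0" "Q *v w = z *s w"
    using complex_matrix_has_eigenvector by blast
  then have z: "cmod z \<in> ?S" by auto
  have le: "s \<le> R" if "s \<in> ?S" for s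
    using that assms by auto
  have "cmod z \<le> Sup ?S"
    using z le by (intro cSup_upper bdd_aboveI[of _ R]) auto
  moreover have "Sup ?S \<le> R"
    using z le by (intro cSup_least) auto
  ultimately show ?thesis
    unfolding spectral_radius_def using norm_ge_zero order_trans by blast
qed

section \<open>Synthesis operators\<close>

lemma synthesis_add: "synthesis \<phi> (u + v) = synthesis \<phi> u + synthesis \<phi> v"
  by (simp add: synthesis_def scaleC_add_left sum.distrib)

lemma synthesis_scale: "synthesis \<phi> (z *s u) = z *\<^sub>C synthesis \<phi> u"
  by (simp add: synthesis_def complex_vector.scale_sum_right scaleC_scaleC)

lemma bounded_linear_synthesis: "bounded_linear (synthesis \<phi>)"
proof -
  have "synthesis \<phi> (r *\<^sub>R u) = r *\<^sub>R synthesis \<phi> u" for r u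
    by (simp add: synthesis_def scaleR_scaleC scaleR_conv_of_real[where 'a = complex] complex_vector.scale_sum_right
        scaleC_scaleC)
  then have "linear (synthesis \<phi>)"
    by (intro linearI) (simp_all add: synthesis_add)
  then show ?thesis
    by (simp add: linear_conv_bounded_linear)
qed

lemma synthesis_eq_0_iff:
  assumes "complex_basis \<phi> S"
  shows "synthesis \<phi> u = 0 \<longleftrightarrow> u = 0"
proof
  assume u: "synthesis \<phi> u = 0"
  have inj: "inj \<phi>" and ind: "complex_vector.independent (range \<phi>)"
    using assms by (auto simp: complex_basis_def)
  \<comment> \<open>Injectivity turns the sum over indices into a sum over basis vectors, the form
    to which independence of a set applies.\<close>
  have "(\<Sum>x\<in>range \<phi>. (u $ inv \<phi> x) *\<^sub>C x) = 0"
    using u inj by (simp add: synthesis_def sum.reindex)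
  then have "u $ inv \<phi> x = 0" if "x \<in> range \<phi>" for x
    using complex_vector.independentD[OF ind] that by (meson finite finite_imageI subset_refl)
  then show "u = 0"
    using inj by (metis inv_f_f rangeI vec_eq_iff zero_index)
qed (simp add: synthesis_def)

lemma range_synthesis:
  assumes "complex_basis \<phi> S"
  shows "range (synthesis \<phi>) = S"
proof -
  have inj: "inj \<phi>" and S: "S = complex_vector.span (range \<phi>)"
    using assms by (auto simp: complex_basis_def)
  have "(\<Sum>x\<in>range \<phi>. k x *\<^sub>C x) \<in> range (synthesis \<phi>)" for k
    using inj by (intro range_eqI[of _ _ "\<chi> i. k (\<phi> i)"]) (simp add: synthesis_def sum.reindex)
  moreover have "synthesis \<phi> u = (\<Sum>x\<in>range \<phi>. (u $ inv \<phi> x) *\<^sub>C x)" for u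
    using inj by (simp add: synthesis_def sum.reindex)
  ultimately show ?thesis
    unfolding S complex_vector.span_finite[OF finite_imageI[OF finite]]
    by auto
qed

lemma norm_synthesis_le:
  assumes "complex_basis \<phi> S"
  shows "norm (synthesis \<phi> u) \<le> synthesis_upper \<phi> * norm u"
proof (cases "u = 0")
  case False
  obtain K where K: "norm (synthesis \<phi> v) \<le> norm v * K" for v
    using bounded_linear.bounded[OF bounded_linear_synthesis] by blast
  have "norm (synthesis \<phi> u) / norm u \<le> synthesis_upper \<phi>"
    unfolding synthesis_upper_def
  proof (rule cSUP_upper)
    show "bdd_above ((\<lambda>u. norm (synthesis \<phi> u) / norm u) ` {u. synthesis \<phi> u \<noteq> 0})"
      using K by (intro bdd_aboveI2[of _ _ K])
        (auto simp: synthesis_eq_0_iff[OF assms] divide_le_eq mult.commute)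
  qed (use False in \<open>simp add: synthesis_eq_0_iff[OF assms]\<close>)
  then show ?thesis
    using False by (simp add: divide_le_eq)
qed (simp add: synthesis_def)

text \<open>Compactness of the unit sphere of coefficient vectors: the norm of the synthesized
  function attains its minimum there, and this is nonzero because synthesis is injective.\<close>

lemma synthesis_lower_pos:
  fixes \<phi> :: "'n::finite \<Rightarrow> 'a::complex_banach"
  assumes "complex_basis \<phi> S"
  shows "synthesis_lower \<phi> > 0"
proof -
  have "continuous_on (sphere 0 1) (\<lambda>u. norm (synthesis \<phi> u))"
    by (intro continuous_intros linear_continuous_on bounded_linear_synthesis)
  moreover have "sphere (0::complex ^ 'n) 1 \<noteq> {}"
    by simp
  ultimately obtain v where v: "v \<in> sphere 0 1"
      "\<And>u. u \<in> sphere 0 1 \<Longrightarrow> norm (synthesis \<phi> v) \<le> norm (synthesis \<phi> u)"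
    using continuous_attains_inf[OF compact_sphere] by blast
  \<comment> \<open>Homogeneity carries the minimum on the sphere over to all quotients.\<close>
  have "norm (synthesis \<phi> v) \<le> norm (synthesis \<phi> u) / norm u" if "u \<noteq> 0" for u
  proof -
    have "norm (synthesis \<phi> v) \<le> norm (synthesis \<phi> (u /\<^sub>R norm u))"
      using that by (intro v) simp
    also have "\<dots> = norm (synthesis \<phi> u) / norm u"
      by (simp add: linear_scale[OF bounded_linear.linear[OF bounded_linear_synthesis]]
          divide_inverse_commute)
    finally show ?thesis .
  qed
  moreover have "{u. synthesis \<phi> u \<noteq> 0} \<noteq> {}"
    using v(1) by (auto simp: synthesis_eq_0_iff[OF assms] intro!: exI[of _ v])
  ultimately have "norm (synthesis \<phi> v) \<le> synthesis_lower \<phi>"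
    unfolding synthesis_lower_def
    by (intro cINF_greatest) (auto simp: synthesis_eq_0_iff[OF assms])
  moreover have "norm (synthesis \<phi> v) > 0"
    using v(1) by (auto simp: synthesis_eq_0_iff[OF assms])
  ultimately show ?thesis by (rule less_le_trans[rotated])
qed

lemma synthesis_lower_le:
  assumes "complex_basis \<phi> S"
  shows "synthesis_lower \<phi> * norm u \<le> norm (synthesis \<phi> u)"
proof (cases "u = 0")
  case False
  have "synthesis_lower \<phi> \<le> norm (synthesis \<phi> u) / norm u"
    unfolding synthesis_lower_def
    using False by (intro cINF_lower bdd_belowI2[of _ 0]) (auto simp: synthesis_eq_0_iff[OF assms])
  then show ?thesis
    using False by (simp add: le_divide_eq)
qed simp

section \<open>Condition numbers\<close>

text \<open>Eigenvalues can be measured in the norm of the function space: synthesizing an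
  eigenvector and cancelling its norm leaves no factor depending on the basis.\<close>

lemma spectral_radius_le_synthesis:
  fixes Q :: "complex ^ 'n ^ 'n"
  assumes basis: "complex_basis \<phi> S"
    and Q: "\<And>u. norm (synthesis \<phi> (Q *v u)) \<le> R * norm (synthesis \<phi> u)"
  shows "0 \<le> spectral_radius Q \<and> spectral_radius Q \<le> R"
proof (rule spectral_radius_nonneg_le)
  fix z v assume v: "v \<noteq> 0" "Q *v v = z *s v"
  have "cmod z * norm (synthesis \<phi> v) \<le> R * norm (synthesis \<phi> v)"
    using Q[of v] by (simp add: v synthesis_scale norm_scaleC)
  then show "cmod z \<le> R"
    using v(1) by (simp add: synthesis_eq_0_iff[OF basis])
qed

text \<open>Passing from coefficients to functions costs \<open>synthesis_upper\<close>, and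
  returning costs the reciprocal of \<open>synthesis_lower\<close>.\<close>

lemma onorm_matrix_le_synthesis:
  fixes Q :: "complex ^ 'n ^ 'n"
  assumes basis: "complex_basis \<phi> S" and "0 \<le> R"
    and Q: "\<And>u. norm (synthesis \<phi> (Q *v u)) \<le> R * norm (synthesis \<phi> u)"
  shows "onorm ((*v) Q) \<le> R * synthesis_cond \<phi>"
proof (rule onorm_le)
  fix u
  have "synthesis_lower \<phi> * norm (Q *v u) \<le> norm (synthesis \<phi> (Q *v u))"
    by (rule synthesis_lower_le[OF basis])
  also have "\<dots> \<le> R * norm (synthesis \<phi> u)"
    by (rule Q)
  also have "\<dots> \<le> R * (synthesis_upper \<phi> * norm u)"
    using \<open>0 \<le> R\<close> by (intro mult_left_mono norm_synthesis_le[OF basis])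
  finally show "norm (Q *v u) \<le> R * synthesis_cond \<phi> * norm u"
    using synthesis_lower_pos[OF basis] by (simp add: synthesis_cond_def field_simps)
qed

lemma matrix_inv_mult:
  assumes "invertible Q"
  shows "Q ** matrix_inv Q = mat 1" "matrix_inv Q ** Q = mat 1"
proof -
  have "Q ** matrix_inv Q = mat 1 \<and> matrix_inv Q ** Q = mat 1"
    using assms unfolding invertible_def matrix_inv_def by (rule someI_ex)
  then show "Q ** matrix_inv Q = mat 1" "matrix_inv Q ** Q = mat 1"
    by simp_all
qed

lemma matrix_inv_cancel:
  assumes "invertible Q"
  shows "Q *v (matrix_inv Q *v u) = u" "matrix_inv Q *v (Q *v u) = u"
  by (simp_all add: matrix_vector_mul_assoc matrix_inv_mult assms)

lemma invertible_matrix_inv: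
  assumes "invertible Q"
  shows "invertible (matrix_inv Q)"
  using matrix_inv_mult[OF assms] unfolding invertible_def by blast

text \<open>Inserting \<open>matrix_inv Q *v u\<close> into the lower bound for \<open>Q\<close>
  makes it an upper bound for the inverse, so both factors of each condition number are estimated
  alike.\<close>

lemma condition_numbers_le:
  fixes Q :: "complex ^ 'n ^ 'n"
  assumes basis: "complex_basis \<phi> S" and inv: "invertible Q" and "0 \<le> R" "0 \<le> R'"
    and upper: "\<And>u. norm (synthesis \<phi> (Q *v u)) \<le> R * norm (synthesis \<phi> u)"
    and lower: "\<And>u. norm (synthesis \<phi> u) \<le> R' * norm (synthesis \<phi> (Q *v u))"
  shows "cond_S Q \<le> R * R'" "cond_2 Q \<le> R * R' * (synthesis_cond \<phi>)\<^sup>2"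
proof -
  have inverse: "norm (synthesis \<phi> (matrix_inv Q *v u)) \<le> R' * norm (synthesis \<phi> u)" for u
    using lower[of "matrix_inv Q *v u"] by (simp add: matrix_inv_cancel[OF inv])
  show "cond_S Q \<le> R * R'"
    unfolding cond_S_def
    using spectral_radius_le_synthesis[OF basis upper] spectral_radius_le_synthesis[OF basis inverse]
      \<open>0 \<le> R\<close> by (intro mult_mono) auto
  have pos: "0 \<le> onorm ((*v) B)" for B :: "complex ^ 'n ^ 'n"
    by (simp add: onorm_pos_le)
  \<comment> \<open>\<open>R * synthesis_cond \<phi>\<close> is nonnegative because it dominates an
    operator norm.\<close>
  have "cond_2 Q \<le> (R * synthesis_cond \<phi>) * (R' * synthesis_cond \<phi>)"
    unfolding cond_2_def
    using onorm_matrix_le_synthesis[OF basis \<open>0 \<le> R\<close> upper]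
      onorm_matrix_le_synthesis[OF basis \<open>0 \<le> R'\<close> inverse] pos
    by (intro mult_mono) (auto intro: order_trans)
  then show "cond_2 Q \<le> R * R' * (synthesis_cond \<phi>)\<^sup>2"
    by (simp add: power2_eq_square mult_ac)
qed

section \<open>Galerkin matrices and discrete stability\<close>

lemma cmod_le_form_norm:
  assumes b: "bounded_sesquilinear b"
  shows "cmod (b x y) \<le> form_norm b * norm x * norm y"
proof (cases "x = 0 \<or> y = 0")
  case True
  \<comment> \<open>\<open>form_norm\<close> leaves out zero arguments; additivity makes the form
    vanish at them.\<close>
  have "b 0 y = b 0 y + b 0 y" "b x 0 = b x 0 + b x 0"
    using b unfolding bounded_sesquilinear_def by (metis add_0)+
  with True show ?thesis by auto
next
  case False
  obtain K where K: "\<And>x y. cmod (b x y) \<le> K * norm x * norm y"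
    using b unfolding bounded_sesquilinear_def by blast
  have "(\<lambda>(x, y). cmod (b x y) / (norm x * norm y)) (x, y) \<le> form_norm b"
    unfolding form_norm_def
  proof (rule cSUP_upper)
    show "bdd_above ((\<lambda>(x, y). cmod (b x y) / (norm x * norm y)) ` ((- {0}) \<times> (- {0})))"
      using K by (intro bdd_aboveI2[of _ _ K]) (auto intro!: mult_imp_div_pos_le simp: mult.assoc)
  qed (use False in auto)
  then show ?thesis
    using False by (simp add: divide_le_eq mult.assoc)
qed

text \<open>The bridge between matrices and forms: equal matrix-vector products mean equal values
  against every discrete test function. The conjugate reflects antilinearity in the test
  function.\<close>

lemma galerkin_matrix_inner:
  assumes b: "bounded_sesquilinear b"
  shows "b (synthesis \<phi> u) (synthesis \<theta> v) = (\<Sum>i\<in>UNIV. cnj (v $ i) * (galerkin_matrix b \<phi> \<theta> *v u) $ i)"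
proof -
  have add: "b (x + x') y = b x y + b x' y" "b x (y + y') = b x y + b x y'"
    and scale: "b (z *\<^sub>C x) y = z * b x y" "b x (z *\<^sub>C y) = cnj z * b x y" for x x' y y' z
    using b unfolding bounded_sesquilinear_def by auto
  have zero: "b 0 y = 0" "b x 0 = 0" for x y
    using add(1)[of 0 0 y] add(2)[of x 0 0] by auto
  have left: "b (\<Sum>i\<in>I. f i) y = (\<Sum>i\<in>I. b (f i) y)" for f y and I :: "'c set"
    by (induction I rule: infinite_finite_induct) (simp_all add: zero add)
  have right: "b x (\<Sum>i\<in>I. f i) = (\<Sum>i\<in>I. b x (f i))" for f x and I :: "'c set"
    by (induction I rule: infinite_finite_induct) (simp_all add: zero add)
  show ?thesis
    by (simp add: synthesis_def left right scale galerkin_matrix_def matrix_vector_mult_def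
        mult.commute)
qed

text \<open>An inf-sup condition with the supremum replaced by arbitrary upper bounds
  \<open>B\<close>, so that later estimates need not handle suprema.\<close>

definition discretely_stable ::
  "('a::complex_banach \<Rightarrow> 'b::complex_banach \<Rightarrow> complex) \<Rightarrow> 'a set \<Rightarrow> 'b set \<Rightarrow> real \<Rightarrow> bool" where
  "discretely_stable b S T \<delta> \<longleftrightarrow>
     (\<forall>x\<in>S. \<forall>B. (\<forall>y\<in>T. cmod (b x y) \<le> B * norm y) \<longrightarrow> \<delta> * norm x \<le> B)"

lemma inf_sup_imp_discretely_stable:
  assumes infsup: "inf_sup_condition b S T \<delta>" and basis: "complex_basis \<theta> T"
  shows "discretely_stable b S T \<delta>"
  unfolding discretely_stable_def
proof (intro ballI allI impI)
  fix x B assume x: "x \<in> S" and B: "\<forall>y\<in>T. cmod (b x y) \<le> B * norm y"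
  \<comment> \<open>A nonzero test function is required, since the supremum is bounded by
    \<open>B\<close> only over a nonempty set.\<close>
  have "synthesis \<theta> 1 \<in> T - {0}"
    using range_synthesis[OF basis] by (auto simp: synthesis_eq_0_iff[OF basis])
  then have "(SUP v\<in>T - {0}. cmod (b x v) / norm v) \<le> B"
    using B by (intro cSUP_least) (auto simp: divide_le_eq)
  with infsup x show "\<delta> * norm x \<le> B"
    unfolding inf_sup_condition_def by (meson order_trans)
qed

lemma perturbation_dist_le:
  assumes "b' \<in> perturbations \<gamma> S T \<nu> b" "\<gamma> > 0" "x \<in> S" "y \<in> T"
  shows "cmod (b x y - b' x y) \<le> \<gamma> * \<nu> * norm x * norm y"
proof -
  have "inverse \<gamma> * cmod (b x y - b' x y) \<le> \<nu> * norm x * norm y"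
    using assms by (simp add: perturbations_def)
  then show ?thesis
    using \<open>\<gamma> > 0\<close> by (simp add: field_simps)
qed

text \<open>If \<open>B\<close> bounds \<open>b' x\<close> on \<open>T\<close>, then
  \<open>B + \<gamma> * \<nu> * norm x\<close> bounds \<open>b x\<close>. Stability of
  \<open>b\<close> applies, and the extra term is absorbed on the left; measuring the perturbation
  relative to \<open>\<gamma>\<close> yields the factor \<open>1 - \<nu>\<close>.\<close>

lemma discretely_stable_perturbation:
  assumes b': "b' \<in> perturbations \<gamma> S T \<nu> b" and "\<gamma> > 0" and stable: "discretely_stable b S T \<gamma>"
  shows "discretely_stable b' S T (\<gamma> * (1 - \<nu>))"
  unfolding discretely_stable_def
proof (intro ballI allI impI)
  fix x B assume x: "x \<in> S" and B: "\<forall>y\<in>T. cmod (b' x y) \<le> B * norm y"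
  have "cmod (b x y) \<le> (B + \<gamma> * \<nu> * norm x) * norm y" if "y \<in> T" for y
    using norm_triangle_sub[of "b x y" "b' x y"] perturbation_dist_le[OF b' \<open>\<gamma> > 0\<close> x that] B that
    by (fastforce simp: algebra_simps)
  then have "\<gamma> * norm x \<le> B + \<gamma> * \<nu> * norm x"
    using stable x unfolding discretely_stable_def by blast
  then show "\<gamma> * (1 - \<nu>) * norm x \<le> B"
    by (simp add: algebra_simps)
qed

text \<open>Continuity supplies an admissible \<open>B\<close> in the stability condition, tested at
  one nonzero trial function.\<close>

lemma discretely_stable_le_form_norm:
  assumes b: "bounded_sesquilinear b" and stable: "discretely_stable b S T \<delta>"
    and basis: "complex_basis \<phi> S"
  shows "\<delta> \<le> form_norm b"
proof -
  let ?x = "synthesis \<phi> 1"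
  have x: "?x \<in> S" "?x \<noteq> 0"
    using range_synthesis[OF basis] by (auto simp: synthesis_eq_0_iff[OF basis])
  have "\<delta> * norm ?x \<le> form_norm b * norm ?x"
    using stable x(1) cmod_le_form_norm[OF b] unfolding discretely_stable_def by blast
  with x(2) show ?thesis by simp
qed

text \<open>The deviation is at most \<open>\<gamma> * \<nu>\<close>, and
  \<open>\<gamma> \<le> form_norm b\<close> converts this into a relative error of the form norm.
  Closeness is known on the discrete spaces only, hence so is the bound.\<close>

lemma perturbation_bound:
  assumes b: "bounded_sesquilinear b" and b': "b' \<in> perturbations \<gamma> S T \<nu> b"
    and "\<gamma> > 0" "\<gamma> \<le> form_norm b" "0 \<le> \<nu>" "x \<in> S" "y \<in> T"
  shows "cmod (b' x y) \<le> form_norm b * (1 + \<nu>) * norm x * norm y"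
proof -
  have "cmod (b' x y) \<le> cmod (b x y) + cmod (b x y - b' x y)"
    by (metis norm_minus_commute norm_triangle_sub)
  also have "\<dots> \<le> form_norm b * norm x * norm y + \<gamma> * \<nu> * norm x * norm y"
    using assms by (intro add_mono cmod_le_form_norm perturbation_dist_le)
  also have "\<dots> \<le> form_norm b * norm x * norm y + form_norm b * \<nu> * norm x * norm y"
    using assms by (intro add_left_mono mult_right_mono) auto
  finally show ?thesis
    by (simp add: algebra_simps)
qed

text \<open>A kernel vector synthesizes to a function on which the form vanishes against all of
  \<open>T\<close>; stability with \<open>B = 0\<close> makes it zero. The matrix is square, so a
  trivial kernel suffices.\<close>

lemma invertible_galerkin_matrix:
  assumes "bounded_sesquilinear b" and stable: "discretely_stable b S T \<delta>" and "\<delta> > 0"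
    and basis: "complex_basis \<phi> S" "complex_basis \<theta> T"
  shows "invertible (galerkin_matrix b \<phi> \<theta>)"
proof -
  have "u = 0" if u: "galerkin_matrix b \<phi> \<theta> *v u = 0" for u
  proof -
    have "b (synthesis \<phi> u) y = 0" if "y \<in> T" for y
      using that galerkin_matrix_inner[OF assms(1), of \<phi> u \<theta>] range_synthesis[OF basis(2)] u
      by auto
    moreover have "synthesis \<phi> u \<in> S"
      using range_synthesis[OF basis(1)] by auto
    ultimately have "\<delta> * norm (synthesis \<phi> u) \<le> 0"
      using stable unfolding discretely_stable_def by fastforce
    then show "u = 0"
      using \<open>\<delta> > 0\<close> synthesis_eq_0_iff[OF basis(1)] by (simp add: mult_le_0_iff)
  qed
  then show ?thesis
    by (simp add: invertible_left_inverse matrix_left_invertible_ker)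
qed

text \<open>Both functions induce the same functional on \<open>T\<close>. Boundedness of
  \<open>b\<close> controls it from above, and stability of \<open>d\<close> recovers the norm of
  the other function.\<close>

lemma galerkin_matrix_transfer:
  assumes "bounded_sesquilinear b" "bounded_sesquilinear d"
    and basis: "complex_basis \<phi> S" "complex_basis \<psi> S'" "complex_basis \<theta> T"
    and eq: "galerkin_matrix d \<psi> \<theta> *v w = galerkin_matrix b \<phi> \<theta> *v u"
    and bound: "\<And>x y. x \<in> S \<Longrightarrow> y \<in> T \<Longrightarrow> cmod (b x y) \<le> \<beta> * norm x * norm y"
    and stable: "discretely_stable d S' T \<delta>"
  shows "\<delta> * norm (synthesis \<psi> w) \<le> \<beta> * norm (synthesis \<phi> u)"
proof -
  have "d (synthesis \<psi> w) y = b (synthesis \<phi> u) y" if "y \<in> T" for y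
    using that galerkin_matrix_inner[OF assms(1), of \<phi> u \<theta>]
      galerkin_matrix_inner[OF assms(2), of \<psi> w \<theta>] range_synthesis[OF basis(3)] eq
    by auto
  moreover have "synthesis \<phi> u \<in> S" "synthesis \<psi> w \<in> S'"
    using range_synthesis[OF basis(1)] range_synthesis[OF basis(2)] by auto
  ultimately show ?thesis
    using stable bound unfolding discretely_stable_def by metis
qed

section \<open>Two-sided bounds for the preconditioned Galerkin matrix\<close>

theorem theorem2:
  fixes a a\<^sub>\<nu> :: "'x::complex_banach \<Rightarrow> 'y::complex_banach \<Rightarrow> complex"
    and c c\<^sub>\<mu> :: "'v::complex_banach \<Rightarrow> 'w::complex_banach \<Rightarrow> complex"
    and n :: "'v \<Rightarrow> 'y \<Rightarrow> complex"
    and m :: "'x \<Rightarrow> 'w \<Rightarrow> complex"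
    and Xh :: "'x set" and Yh :: "'y set" and Vh :: "'v set" and Wh :: "'w set"
    and \<phi> :: "'n::finite \<Rightarrow> 'x" and \<theta> :: "'n \<Rightarrow> 'y" and \<psi> :: "'n \<Rightarrow> 'v" and \<xi> :: "'n \<Rightarrow> 'w"
    and \<gamma>A \<gamma>C \<gamma>N \<gamma>M \<mu> \<nu> :: real
  assumes "reflexive_space TYPE('x)" "reflexive_space TYPE('y)"
      "reflexive_space TYPE('v)" "reflexive_space TYPE('w)"
    and "bounded_sesquilinear a" "bounded_sesquilinear c"
      "bounded_sesquilinear n" "bounded_sesquilinear m"
    and "\<And>b. bounded_antilinear b \<Longrightarrow> \<exists>!u. \<forall>v. a u v = b v"
    and "complex_vector.subspace Xh" "complex_vector.dim Xh = CARD('n)"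
    and "complex_vector.subspace Yh" "complex_vector.dim Yh = CARD('n)"
    and "complex_vector.subspace Vh" "complex_vector.dim Vh = CARD('n)"
    and "complex_vector.subspace Wh" "complex_vector.dim Wh = CARD('n)"
    and "\<gamma>A > 0" "inf_sup_condition a Xh Yh \<gamma>A"
    and "\<gamma>C > 0" "inf_sup_condition c Vh Wh \<gamma>C"
    and "\<gamma>N > 0" "inf_sup_condition n Vh Yh \<gamma>N"
    and "\<gamma>M > 0" "inf_sup_condition m Xh Wh \<gamma>M"
    and "complex_basis \<phi> Xh" "complex_basis \<theta> Yh" "complex_basis \<psi> Vh" "complex_basis \<xi> Wh"
    and "\<mu> \<in> {0..<1}" "\<nu> \<in> {0..<1}"
    and "c\<^sub>\<mu> \<in> perturbations \<gamma>C Vh Wh \<mu> c"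
    and "a\<^sub>\<nu> \<in> perturbations \<gamma>A Xh Yh \<nu> a"
  shows
    "let A = galerkin_matrix a\<^sub>\<nu> \<phi> \<theta>;
         C = galerkin_matrix c\<^sub>\<mu> \<psi> \<xi>;
         N = galerkin_matrix n \<psi> \<theta>;
         M = galerkin_matrix m \<phi> \<xi>;
         P = matrix_inv M ** C ** matrix_inv N;
         K = form_norm m * form_norm n * form_norm c * form_norm a / (\<gamma>M * \<gamma>N * \<gamma>C * \<gamma>A);
         K' = K * ((1 + \<mu>) / (1 - \<mu>)) * ((1 + \<nu>) / (1 - \<nu>))
     in invertible M \<and> invertible N \<and> invertible (P ** A) \<and>
        cond_S (P ** A) \<le> K' \<and>
        cond_2 (P ** A) \<le> K' * (synthesis_cond \<phi>)\<^sup>2"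
proof -
  define A where "A = galerkin_matrix a\<^sub>\<nu> \<phi> \<theta>"
  define C where "C = galerkin_matrix c\<^sub>\<mu> \<psi> \<xi>"
  define N where "N = galerkin_matrix n \<psi> \<theta>"
  define M where "M = galerkin_matrix m \<phi> \<xi>"
  define Q where "Q = matrix_inv M ** C ** matrix_inv N ** A"
  note forms = assms(5-8)
  note pos = \<open>\<gamma>A > 0\<close> \<open>\<gamma>C > 0\<close> \<open>\<gamma>N > 0\<close> \<open>\<gamma>M > 0\<close>
  note bases = \<open>complex_basis \<phi> Xh\<close> \<open>complex_basis \<theta> Yh\<close> \<open>complex_basis \<psi> Vh\<close> \<open>complex_basis \<xi> Wh\<close>
  note a\<nu> = \<open>a\<^sub>\<nu> \<in> perturbations \<gamma>A Xh Yh \<nu> a\<close>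
  note c\<mu> = \<open>c\<^sub>\<mu> \<in> perturbations \<gamma>C Vh Wh \<mu> c\<close>
  have a\<nu>_form: "bounded_sesquilinear a\<^sub>\<nu>" and c\<mu>_form: "bounded_sesquilinear c\<^sub>\<mu>"
    using a\<nu> c\<mu> by (simp_all add: perturbations_def)
  have \<mu>\<nu>: "0 \<le> \<mu>" "0 < 1 - \<mu>" "0 \<le> \<nu>" "0 < 1 - \<nu>"
    using \<open>\<mu> \<in> {0..<1}\<close> \<open>\<nu> \<in> {0..<1}\<close> by auto
  have stable: "discretely_stable a Xh Yh \<gamma>A" "discretely_stable c Vh Wh \<gamma>C"
      "discretely_stable n Vh Yh \<gamma>N" "discretely_stable m Xh Wh \<gamma>M"
    by (rule inf_sup_imp_discretely_stable; fact)+
  have stable': "discretely_stable a\<^sub>\<nu> Xh Yh (\<gamma>A * (1 - \<nu>))" "discretely_stable c\<^sub>\<mu> Vh Wh (\<gamma>C * (1 - \<mu>))"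
    by (rule discretely_stable_perturbation; fact)+
  have norms: "\<gamma>A \<le> form_norm a" "\<gamma>C \<le> form_norm c" "\<gamma>N \<le> form_norm n" "\<gamma>M \<le> form_norm m"
    by (rule discretely_stable_le_form_norm; fact)+
  have inv: "invertible M" "invertible N"
    unfolding M_def N_def by (rule invertible_galerkin_matrix; fact)+
  \<comment> \<open>Here \<open>\<mu>, \<nu> < 1\<close> enters: the perturbed forms keep positive
    stability constants.\<close>
  have "0 < \<gamma>A * (1 - \<nu>)" "0 < \<gamma>C * (1 - \<mu>)"
    using pos \<mu>\<nu> by simp_all
  then have inv': "invertible A" "invertible C"
    unfolding A_def C_def
    by (auto intro: invertible_galerkin_matrix a\<nu>_form c\<mu>_form stable' bases)
  have Q_inv: "invertible Q"
    unfolding Q_def by (intro invertible_mult invertible_matrix_inv inv inv')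

  \<comment> \<open>\<open>R\<close> combines boundedness of the perturbed \<open>c\<close>,
    \<open>a\<close> with stability of \<open>m\<close>, \<open>n\<close>; \<open>R'\<close>
    exchanges these roles to bound the inverse.\<close>
  define R where "R = form_norm c * (1 + \<mu>) / \<gamma>M * (form_norm a * (1 + \<nu>) / \<gamma>N)"
  define R' where "R' = form_norm n / (\<gamma>A * (1 - \<nu>)) * (form_norm m / (\<gamma>C * (1 - \<mu>)))"
  \<comment> \<open>The form norms are positive because they dominate the positive inf-sup
    constants.\<close>
  have nonneg: "0 \<le> R" "0 \<le> R'"
    unfolding R_def R'_def using pos norms \<mu>\<nu> by simp_all
  have bounds: "norm (synthesis \<phi> (Q *v u)) \<le> R * norm (synthesis \<phi> u) \<and>
      norm (synthesis \<phi> u) \<le> R' * norm (synthesis \<phi> (Q *v u))" for u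
  proof -
    define w where "w = matrix_inv N *v (A *v u)"
    have w: "N *v w = A *v u"
      by (simp add: w_def matrix_inv_cancel inv)
    have z: "M *v (Q *v u) = C *v w"
      by (simp add: Q_def w_def matrix_inv_cancel inv flip: matrix_vector_mul_assoc)
    let ?u = "norm (synthesis \<phi> u)" and ?w = "norm (synthesis \<psi> w)"
      and ?z = "norm (synthesis \<phi> (Q *v u))"
    \<comment> \<open>The two identities for \<open>w\<close> and \<open>Q *v u\<close> are each
      used in both directions: first for the upper bound on \<open>Q\<close>, then reversed for the
      lower bound.\<close>
    have "\<gamma>N * ?w \<le> form_norm a * (1 + \<nu>) * ?u"
      using w unfolding N_def A_def
      by (rule galerkin_matrix_transfer[OF a\<nu>_form forms(3) bases(1,3,2)])
        (use perturbation_bound[OF forms(1) a\<nu> pos(1) norms(1) \<mu>\<nu>(3)] stable(3) in auto)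
    moreover have "\<gamma>M * ?z \<le> form_norm c * (1 + \<mu>) * ?w"
      using z unfolding M_def C_def
      by (rule galerkin_matrix_transfer[OF c\<mu>_form forms(4) bases(3,1,4)])
        (use perturbation_bound[OF forms(2) c\<mu> pos(2) norms(2) \<mu>\<nu>(1)] stable(4) in auto)
    moreover have "\<gamma>A * (1 - \<nu>) * ?u \<le> form_norm n * ?w"
      using w[symmetric] unfolding N_def A_def
      by (rule galerkin_matrix_transfer[OF forms(3) a\<nu>_form bases(3,1,2)])
        (use cmod_le_form_norm[OF forms(3)] stable'(1) in auto)
    moreover have "\<gamma>C * (1 - \<mu>) * ?w \<le> form_norm m * ?z"
      using z[symmetric] unfolding M_def C_def
      by (rule galerkin_matrix_transfer[OF forms(4) c\<mu>_form bases(1,3,4)])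
        (use cmod_le_form_norm[OF forms(4)] stable'(2) in auto)
    ultimately have w_le: "?w \<le> form_norm a * (1 + \<nu>) / \<gamma>N * ?u"
      and z_le: "?z \<le> form_norm c * (1 + \<mu>) / \<gamma>M * ?w"
      and u_le: "?u \<le> form_norm n / (\<gamma>A * (1 - \<nu>)) * ?w"
      and w_le': "?w \<le> form_norm m / (\<gamma>C * (1 - \<mu>)) * ?z"
      using pos \<mu>\<nu> by (simp_all add: pos_le_divide_eq mult.commute)
    have "?z \<le> R * ?u"
      unfolding R_def mult.assoc using pos norms \<mu>\<nu> w_le
      by (intro order_trans[OF z_le] mult_left_mono) simp_all
    moreover have "?u \<le> R' * ?z"
      unfolding R'_def mult.assoc using pos norms \<mu>\<nu> w_le'
      by (intro order_trans[OF u_le] mult_left_mono) simp_all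
    ultimately show ?thesis ..
  qed
  \<comment> \<open>Each form contributes its norm to one of \<open>R\<close>, \<open>R'\<close> and
    its stability constant to the other, so every quotient occurs exactly once.\<close>
  have "R * R' = form_norm m * form_norm n * form_norm c * form_norm a / (\<gamma>M * \<gamma>N * \<gamma>C * \<gamma>A)
      * ((1 + \<mu>) / (1 - \<mu>)) * ((1 + \<nu>) / (1 - \<nu>))"
    by (simp add: R_def R'_def mult_ac)
  then show ?thesis
    using condition_numbers_le[OF bases(1) Q_inv nonneg] bounds inv Q_inv
    by (simp add: Let_def A_def C_def M_def N_def Q_def)
qed

end
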